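(* Let $\pi$ be an $n\times n$ partial involution of rank $n-k$, let $i_1,\dots,i_k$ be the indices of the zero rows of $\pi$, and let $\tilde\pi\in S_{n-k}$ be the involution obtained from $\pi$ by deleting its zero rows and zero columns. Then $$\mathfrak D(\pi)=\frac{\operatorname{exc}(\tilde\pi)+\operatorname{inv}(\tilde\pi)}{2}+\sum_{t=1}^{k}(n+1-i_t).$$
   Context: A partial involution is a symmetric $n\times n$ $(0,1)$-matrix with at most one $1$ in each row and each column; since it is symmetric, its zero rows and zero columns have the same indices, and deleting them yields the permutation matrix of an involution of $S_{n-k}$. The rank-control matrix $R(\pi)=(r_{ij})_{1\le i,j\le n}$ has $r_{ij}$ equal to the rank of the upper-left $i\times j$ submatrix of $\pi$; set additionally $r_{0k}=0$ for $0\le k<n$, and define $\mathfrak D(\pi)=\#\{(i,j): 1\le i\le j\le n,\ r_{ij}=r_{i-1,j-1}\}$. For $\sigma\in S_m$, $\operatorname{exc}(\sigma)=\#\{i:\sigma(i)>i\}$ is the number of excedances and $\operatorname{inv}(\sigma)=\#\{(i,j): i<j,\ \sigma(i)>\sigma(j)\}$ is the number of inversions. *)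

theory Defs
  imports
    Jordan_Normal_Form.DL_Rank
    Jordan_Normal_Form.DL_Submatrix
    "HOL-Combinatorics.Permutations"
begin

text \<open>Rows and columns carry the indices 1, ..., n in the mathematics, whereas matrices of type
  \<^typ>\<open>'a mat\<close> are indexed from 0. The index sets and permutations below are 1-based; the shift
  occurs only where matrix entries are accessed.\<close>

definition partial_involution :: "nat \<Rightarrow> 'a::field mat \<Rightarrow> bool" where
  "partial_involution n A \<longleftrightarrow>
     A \<in> carrier_mat n n \<and>
     transpose_mat A = A \<and>
     (\<forall>i<n. \<forall>j<n. A $$ (i, j) \<in> {0, 1}) \<and>
     (\<forall>i<n. card {j. j < n \<and> A $$ (i, j) = 1} \<le> 1) \<and>
     (\<forall>j<n. card {i. i < n \<and> A $$ (i, j) = 1} \<le> 1)"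

definition zero_rows :: "'a::field mat \<Rightarrow> nat set" where
  "zero_rows A = {i \<in> {1..dim_row A}. row A (i - 1) = 0\<^sub>v (dim_col A)}"

definition zero_cols :: "'a::field mat \<Rightarrow> nat set" where
  "zero_cols A = {j \<in> {1..dim_col A}. col A (j - 1) = 0\<^sub>v (dim_row A)}"

definition delete_zeros :: "'a::field mat \<Rightarrow> 'a mat" where
  "delete_zeros A = submatrix A {i. Suc i \<notin> zero_rows A} {j. Suc j \<notin> zero_cols A}"

definition perm_matrix :: "nat \<Rightarrow> (nat \<Rightarrow> nat) \<Rightarrow> 'a::field mat" where
  "perm_matrix m \<sigma> = mat m m (\<lambda>(i, j). if \<sigma> (Suc i) = Suc j then 1 else 0)"

text \<open>Meaningful when deleting the zero rows and columns of \<open>A\<close> leaves a permutation matrix, as is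
  the case for a partial involution. An involution has a symmetric permutation matrix, so whether
  \<open>perm_matrix\<close> uses the row or the column convention makes no difference here.\<close>

definition reduced_perm :: "'a::field mat \<Rightarrow> nat \<Rightarrow> nat" where
  "reduced_perm A = (THE \<sigma>. \<sigma> permutes {1..dim_row (delete_zeros A)} \<and>
     delete_zeros A = perm_matrix (dim_row (delete_zeros A)) \<sigma>)"

text \<open>The argument of \<^const>\<open>vec_space.rank\<close> is the number of rows. The case \<open>i = 0\<close> is the convention
  \<open>r\<^sub>0\<^sub>k = 0\<close>; for \<open>i\<close> and \<open>j\<close> not exceeding the dimensions of \<open>A\<close>, the inner matrix is the
  upper-left \<open>i \<times> j\<close> submatrix.\<close>

definition rank_control :: "'a::field mat \<Rightarrow> nat \<Rightarrow> nat \<Rightarrow> nat" where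
  "rank_control A i j =
     (if i = 0 then 0 else vec_space.rank i (mat i j (\<lambda>(a, b). A $$ (a, b))))"

definition frakD :: "nat \<Rightarrow> 'a::field mat \<Rightarrow> nat" where
  "frakD n A = card {(i, j). 1 \<le> i \<and> i \<le> j \<and> j \<le> n \<and>
     rank_control A i j = rank_control A (i - 1) (j - 1)}"

definition exc :: "nat \<Rightarrow> (nat \<Rightarrow> nat) \<Rightarrow> nat" where
  "exc m \<sigma> = card {i \<in> {1..m}. \<sigma> i > i}"

definition inv_count :: "nat \<Rightarrow> (nat \<Rightarrow> nat) \<Rightarrow> nat" where
  "inv_count m \<sigma> = card {(i, j). i \<in> {1..m} \<and> j \<in> {1..m} \<and> i < j \<and> \<sigma> i > \<sigma> j}"

end

theory Submission
  imports Defs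
begin

text \<open>Write \<open>f\<close> for the involution that \<open>\<pi>\<close> induces on the set \<open>S\<close> of its nonzero rows. Since
  \<open>r\<^sub>i\<^sub>j\<close> counts the ones in the upper-left \<open>i \<times> j\<close> block, \<open>r\<^sub>i\<^sub>j = r\<^sub>i\<^sub>-\<^sub>1\<^sub>,\<^sub>j\<^sub>-\<^sub>1\<close> says that
  \<open>f i > j\<close> unless \<open>i \<notin> S\<close>, and \<open>f j > i\<close> unless \<open>j \<notin> S\<close>. Pairs inside \<open>S\<close> with \<open>i = j\<close> are the
  excedances; the off-diagonal ones match half of the inversions that are not of the form
  \<open>(i, f i)\<close>. Every other pair is assigned to a zero index \<open>z\<close> and an arbitrary \<open>w \<ge> z\<close> by
  applying \<open>f\<close> to its member in \<open>S\<close>, if it has one.\<close>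

section \<open>Inversions of an involution\<close>

text \<open>Exceedance and inversion counts depend only on the relative order of the points, so they
  can be taken on the index set \<open>S\<close> itself, without renumbering. Values of
  \<open>f\<close> outside \<open>S\<close> are unconstrained.\<close>

locale finite_involution =
  fixes S :: "'b::linorder set" and f :: "'b \<Rightarrow> 'b"
  assumes finite_S: "finite S"
    and closed: "a \<in> S \<Longrightarrow> f a \<in> S"
    and involutive: "a \<in> S \<Longrightarrow> f (f a) = a"
begin

definition excedances :: "'b set" where
  "excedances = {a \<in> S. a < f a}"

definition inversions :: "('b \<times> 'b) set" where
  "inversions = {(a, b) \<in> S \<times> S. a < b \<and> f b < f a}"

text \<open>Drawing \<open>f\<close> as arcs, two crossing arcs contribute one pair, two nested arcs
  two pairs, and a fixed point under an arc one pair.\<close>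

definition crossings :: "('b \<times> 'b) set" where
  "crossings = {(a, b) \<in> S \<times> S. a < b \<and> b < f a \<and> a < f b}"

text \<open>Inversions are split by comparing \<open>f b\<close> with \<open>a\<close>. Equality
  gives the pairs \<open>(a, f a)\<close>, one per excedance. The map sending \<open>(a, b)\<close>
  to \<open>(f b, f a)\<close> exchanges the two strict cases, and applying \<open>f\<close> to the
  second entry turns the case \<open>a < f b\<close> into \<open>crossings\<close>.\<close>

lemma card_inversions:
  "card inversions = card excedances + 2 * card crossings"
proof -
  let ?L = "{(a, b) \<in> inversions. f b < a}"
  let ?E = "{(a, b) \<in> inversions. f b = a}"
  let ?G = "{(a, b) \<in> inversions. a < f b}"
  have fin: "finite inversions"
    by (rule finite_subset[of _ "S \<times> S"]) (auto simp: inversions_def finite_S)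
  then have fins: "finite ?L" "finite ?E" "finite ?G"
    by (auto intro: finite_subset[of _ inversions])
  have "inversions = (?L \<union> ?E) \<union> ?G" by auto
  then have "card inversions = card ((?L \<union> ?E) \<union> ?G)" by simp
  also have "\<dots> = card (?L \<union> ?E) + card ?G"
    using fins by (intro card_Un_disjoint) auto
  also have "card (?L \<union> ?E) = card ?L + card ?E"
    using fins by (intro card_Un_disjoint) auto
  finally have split: "card inversions = card ?L + card ?E + card ?G" .
  have "bij_betw (\<lambda>(a, b). (f b, f a)) ?L ?G"
    by (rule bij_betw_byWitness[where f' = "\<lambda>(a, b). (f b, f a)"])
      (auto simp: inversions_def closed involutive)
  then have L: "card ?L = card ?G" by (rule bij_betw_same_card)
  have "bij_betw (\<lambda>a. (a, f a)) excedances ?E"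
    by (rule bij_betw_byWitness[where f' = fst])
      (auto simp: inversions_def excedances_def closed involutive)
  then have E: "card excedances = card ?E" by (rule bij_betw_same_card)
  have "bij_betw (\<lambda>(a, b). (a, f b)) ?G crossings"
    by (rule bij_betw_byWitness[where f' = "\<lambda>(a, b). (a, f b)"])
      (auto simp: inversions_def crossings_def closed involutive)
  then have "card ?G = card crossings" by (rule bij_betw_same_card)
  with split L E show ?thesis by simp
qed

end

lemma card_extended_crossings:
  fixes S :: "nat set"
  assumes "finite_involution S f" and S: "S \<subseteq> {..<n}"
  shows "card {(a, b). a \<le> b \<and> b < n \<and> (a \<in> S \<longrightarrow> b < f a) \<and> (b \<in> S \<longrightarrow> a < f b)} =
    card (finite_involution.excedances S f) + card (finite_involution.crossings S f) +
    (\<Sum>z\<in>{..<n} - S. n - z)"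
proof -
  interpret finite_involution S f by fact
  let ?X = "{(a, b). a \<le> b \<and> b < n \<and> (a \<in> S \<longrightarrow> b < f a) \<and> (b \<in> S \<longrightarrow> a < f b)}"
  \<comment> \<open>\<open>?D\<close>, \<open>crossings\<close> and \<open>?O\<close> partition
    \<open>?X\<close>: both indices in \<open>S\<close> and equal, both in \<open>S\<close> and
    distinct, at least one outside \<open>S\<close>.\<close>
  let ?D = "{(a, b) \<in> ?X. a = b \<and> a \<in> S}"
  let ?O = "{(a, b) \<in> ?X. a \<notin> S \<or> b \<notin> S}"
  have lt: "f a < n" "a < n" if "a \<in> S" for a using that closed S by auto
  have below: "a < n" "a < b" if "a \<notin> S" "b \<in> S" "a \<le> b" for a b
    using that lt(2)[of b] by (auto simp: order_le_less)
  have "finite ?X" by (rule finite_subset[of _ "{..<n} \<times> {..<n}"]) auto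
  then have finD: "finite ?D" and finO: "finite ?O"
    by (auto intro: finite_subset[of _ ?X])
  have finC: "finite crossings"
    by (rule finite_subset[of _ "S \<times> S"]) (auto simp: crossings_def finite_S)
  have "?X = (?D \<union> crossings) \<union> ?O"
    using lt by (auto simp: crossings_def)
  then have "card ?X = card ((?D \<union> crossings) \<union> ?O)" by (rule arg_cong)
  also have "\<dots> = card (?D \<union> crossings) + card ?O"
    using finD finC finO by (intro card_Un_disjoint) (auto simp: crossings_def)
  also have "card (?D \<union> crossings) = card ?D + card crossings"
    using finD finC by (intro card_Un_disjoint) (auto simp: crossings_def)
  finally have split: "card ?X = card ?D + card crossings + card ?O" .
  have "bij_betw (\<lambda>a. (a, a)) excedances ?D"
    by (rule bij_betw_byWitness[where f' = fst]) (auto simp: excedances_def lt)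
  then have D: "card excedances = card ?D" by (rule bij_betw_same_card)
  have "bij_betw (\<lambda>(a, b). if a \<in> S then (b, f a) else if b \<in> S then (a, f b) else (a, b))
      ?O (SIGMA z:{..<n} - S. {z..<n})"
    \<comment> \<open>If \<open>w\<close> lies in \<open>S\<close>, the original pair consists of
      \<open>z\<close> and \<open>f w\<close>; since \<open>a \<le> b\<close>, sorting them recovers
      which coordinate was the zero index.\<close>
    by (rule bij_betw_byWitness[where f' = "\<lambda>(z, w). if w \<in> S
          then (min z (f w), max z (f w)) else (z, w)"])
      (auto simp: closed involutive lt below min_def max_def split: if_splits)
  then have "card ?O = card (SIGMA z:{..<n} - S. {z..<n})" by (rule bij_betw_same_card)
  also have "\<dots> = (\<Sum>z\<in>{..<n} - S. n - z)" by simp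
  finally show ?thesis using split D by simp
qed

section \<open>Ranks\<close>

text \<open>The unit vectors among the columns are independent as part of the standard basis. They
  form a maximal independent set of columns, because the only other possible column is zero.\<close>

lemma (in vec_space) rank_unit_zero_cols:
  assumes A: "A \<in> carrier_mat n nc"
    and I: "I \<subseteq> {..<n}"
    and sub: "unit_vec n ` I \<subseteq> set (cols A)"
    and sup: "set (cols A) \<subseteq> insert (0\<^sub>v n) (unit_vec n ` I)"
  shows "rank A = card I"
proof -
  have "unit_vec n ` I \<subseteq> set (unit_vecs n)"
    using I by (auto simp: unit_vecs_def)
  then have ind: "lin_indpt (unit_vec n ` I)"
    using unit_vecs_basis subset_li_is_li unfolding basis_def by blast
  have "maximal (unit_vec n ` I) (\<lambda>T. T \<subseteq> set (cols A) \<and> lin_indpt T)"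
    unfolding maximal_def
  proof (intro conjI allI impI)
    fix T assume T: "unit_vec n ` I \<subseteq> T \<and> T \<subseteq> set (cols A) \<and> lin_indpt T"
    then have "T \<subseteq> carrier_vec n" using A cols_dim by blast
    moreover have "(UNIV :: 'a set) \<noteq> {0}"
      using zero_neq_one by (metis UNIV_I singletonD)
    ultimately have "0\<^sub>v n \<notin> T" using T zero_nin_lin_indpt by simp
    with T sup show "T = unit_vec n ` I" by blast
  qed (use sub ind in auto)
  then have "rank A = card (unit_vec n ` I :: 'a vec set)"
    by (rule rank_card_indpt[OF A])
  also have "\<dots> = card I"
    using I by (intro card_image inj_onI) (simp add: subset_iff unit_vec_eq)
  finally show ?thesis .
qed

text \<open>Normal form of a partial involution, with \<open>S\<close> the 0-based indices of its
  nonzero rows.\<close>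

definition involution_mat :: "nat \<Rightarrow> nat set \<Rightarrow> (nat \<Rightarrow> nat) \<Rightarrow> 'a::field mat" where
  "involution_mat n S f = mat n n (\<lambda>(a, b). if a \<in> S \<and> f a = b then 1 else 0)"

text \<open>\<open>f a\<close> is the column of the only one in row \<open>a\<close>. By symmetry,
  row \<open>f a\<close> has its one in column \<open>a\<close>, so \<open>f\<close> maps
  \<open>S\<close> to itself and is its own inverse there.\<close>

lemma partial_involution_imp_involution_mat:
  fixes A :: "'a::field mat"
  assumes "partial_involution n A"
  obtains S f where "finite_involution S f" "S \<subseteq> {..<n}" "A = involution_mat n S f"
proof -
  have A: "A \<in> carrier_mat n n" and sym: "transpose_mat A = A"
    and zo: "\<And>a b. a < n \<Longrightarrow> b < n \<Longrightarrow> A $$ (a, b) = 0 \<or> A $$ (a, b) = 1"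
    and one: "\<And>a. a < n \<Longrightarrow> card {b. b < n \<and> A $$ (a, b) = 1} \<le> 1"
    using assms unfolding partial_involution_def by auto
  have symA: "A $$ (b, a) = A $$ (a, b)" if "a < n" "b < n" for a b
    using A that arg_cong[OF sym, of "\<lambda>M. M $$ (a, b)"] by auto
  have uniq: "b = c" if "a < n" "b < n" "c < n" "A $$ (a, b) = 1" "A $$ (a, c) = 1" for a b c
  proof -
    have "finite {b. b < n \<and> A $$ (a, b) = 1}" by simp
    then show ?thesis using one[OF that(1)] that by (auto simp: card_le_Suc0_iff_eq)
  qed
  define S where "S = {a. a < n \<and> (\<exists>b<n. A $$ (a, b) = 1)}"
  define f where "f a = (SOME b. b < n \<and> A $$ (a, b) = 1)" for a
  have f: "f a < n \<and> A $$ (a, f a) = 1" if "a \<in> S" for a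
    using that unfolding S_def f_def by (auto intro: someI2_ex)
  have S: "S \<subseteq> {..<n}" by (auto simp: S_def)
  have fS: "f a \<in> S" if "a \<in> S" for a
    using f[OF that] that symA[of a "f a"] by (auto simp: S_def)
  have "f (f a) = a" if "a \<in> S" for a
    using f[OF that] f[OF fS[OF that]] that symA[of a "f a"] uniq[of "f a" "f (f a)" a]
    by (auto simp: S_def)
  then have "finite_involution S f"
    using S fS by unfold_locales (auto intro: finite_subset)
  moreover have "A = involution_mat n S f"
  proof (rule eq_matI)
    fix a b assume "a < dim_row (involution_mat n S f :: 'a mat)"
      and "b < dim_col (involution_mat n S f :: 'a mat)"
    then have ab: "a < n" "b < n" by (auto simp: involution_mat_def)
    have "A $$ (a, b) = 1 \<longleftrightarrow> a \<in> S \<and> f a = b"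
      using ab f uniq[of a b "f a"] by (auto simp: S_def)
    then show "A $$ (a, b) = involution_mat n S f $$ (a, b)"
      using ab zo[of a b] by (auto simp: involution_mat_def)
  qed (use A in \<open>auto simp: involution_mat_def\<close>)
  ultimately show thesis using that S by blast
qed

lemma rank_control_involution_mat:
  assumes "finite_involution S f" and S: "S \<subseteq> {..<n}" and "i \<le> n" "j \<le> n"
  shows "rank_control (involution_mat n S f :: 'a::field mat) i j = card {a \<in> S. a < i \<and> f a < j}"
proof -
  interpret finite_involution S f by fact
  interpret vec_space "TYPE('a)" i .
  let ?B = "mat i j (\<lambda>(a, b). involution_mat n S f $$ (a, b)) :: 'a mat"
  let ?I = "{a \<in> S. a < i \<and> f a < j}"
  \<comment> \<open>The one of column \<open>b\<close> sits in row \<open>f b\<close>, since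
    \<open>f\<close> is its own inverse; it is visible only if that row is among the first
    \<open>i\<close>.\<close>
  have col: "col ?B b = (if b \<in> S \<and> f b < i then unit_vec i (f b) else 0\<^sub>v i)" if "b < j" for b
    using that assms involutive closed by (intro eq_vecI) (auto simp: involution_mat_def unit_vec_def)
  have "rank ?B = card ?I"
  proof (rule rank_unit_zero_cols[where nc = j])
    show "unit_vec i ` ?I \<subseteq> set (cols ?B)"
    proof (rule image_subsetI)
      fix a assume a: "a \<in> ?I"
      then have "unit_vec i a = col ?B (f a)"
        by (subst col) (auto simp: closed involutive)
      with a show "unit_vec i a \<in> set (cols ?B)" by (auto simp: cols_def)
    qed
    show "set (cols ?B) \<subseteq> insert (0\<^sub>v i) (unit_vec i ` ?I)"
      using col by (auto simp: cols_def closed involutive)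
  qed auto
  \<comment> \<open>For \<open>i = 0\<close> the convention in \<open>rank_control\<close> agrees
    with the count over an empty set.\<close>
  then show ?thesis by (simp add: rank_control_def)
qed

text \<open>Ranks count ones, so enlarging a block by row \<open>a\<close> and column
  \<open>b\<close> keeps the rank exactly when these contain no one inside the larger block. The one
  of row \<open>a\<close> is in column \<open>f a\<close>, that of column \<open>b\<close> in row
  \<open>f b\<close>.\<close>

lemma frakD_involution_mat:
  assumes "finite_involution S f" and S: "S \<subseteq> {..<n}"
  shows "frakD n (involution_mat n S f :: 'a::field mat) =
    card {(a, b). a \<le> b \<and> b < n \<and> (a \<in> S \<longrightarrow> b < f a) \<and> (b \<in> S \<longrightarrow> a < f b)}"
proof -
  interpret finite_involution S f by fact
  let ?A = "involution_mat n S f :: 'a mat"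
  have eq: "rank_control ?A (Suc a) (Suc b) = rank_control ?A a b \<longleftrightarrow>
      (a \<in> S \<longrightarrow> b < f a) \<and> (b \<in> S \<longrightarrow> a < f b)" if "a < n" "b < n" for a b
  proof -
    let ?U = "{c \<in> S. c < Suc a \<and> f c < Suc b}" and ?V = "{c \<in> S. c < a \<and> f c < b}"
    \<comment> \<open>\<open>?V\<close> is contained in the finite set \<open>?U\<close>, so equal
      cardinality forces equality.\<close>
    have "card ?U = card ?V \<longleftrightarrow> ?U = ?V"
    proof
      assume "card ?U = card ?V"
      then show "?U = ?V"
        using finite_S by (intro card_subset_eq[symmetric]) auto
    qed simp
    also have "\<dots> \<longleftrightarrow> (\<forall>c\<in>S. c \<le> a \<and> f c \<le> b \<longrightarrow> c < a \<and> f c < b)"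
      unfolding set_eq_iff mem_Collect_eq less_Suc_eq_le
      by (blast intro: order_less_imp_le)
    also have "\<dots> \<longleftrightarrow> (a \<in> S \<longrightarrow> b < f a) \<and> (b \<in> S \<longrightarrow> a < f b)"
    proof (intro iffI conjI impI ballI)
      assume *: "\<forall>c\<in>S. c \<le> a \<and> f c \<le> b \<longrightarrow> c < a \<and> f c < b"
      show "b < f a" if "a \<in> S" using *[rule_format, of a] that by force
      show "a < f b" if "b \<in> S"
        \<comment> \<open>The row holding the one of column \<open>b\<close> is \<open>f b\<close>,
          hence this instance.\<close>
        using *[rule_format, of "f b"] that by (force simp: closed involutive)
    next
      fix c assume *: "(a \<in> S \<longrightarrow> b < f a) \<and> (b \<in> S \<longrightarrow> a < f b)"
        and c: "c \<in> S" "c \<le> a \<and> f c \<le> b"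
      show "c < a" using * c by (cases "c = a") auto
      show "f c < b" using * c closed[of c] involutive[of c] by (cases "f c = b") auto
    qed
    finally have "card ?U = card ?V \<longleftrightarrow> (a \<in> S \<longrightarrow> b < f a) \<and> (b \<in> S \<longrightarrow> a < f b)" .
    moreover have "rank_control ?A (Suc a) (Suc b) = card ?U" "rank_control ?A a b = card ?V"
      using that by (intro rank_control_involution_mat[OF assms]; simp)+
    ultimately show ?thesis by (simp only:)
  qed
  have "bij_betw (\<lambda>(a, b). (Suc a, Suc b))
      {(a, b). a \<le> b \<and> b < n \<and> (a \<in> S \<longrightarrow> b < f a) \<and> (b \<in> S \<longrightarrow> a < f b)}
      {(i, j). 1 \<le> i \<and> i \<le> j \<and> j \<le> n \<and> rank_control ?A i j = rank_control ?A (i - 1) (j - 1)}"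
  proof (rule bij_betw_byWitness[where f' = "\<lambda>(i, j). (i - 1, j - 1)"], goal_cases)
    \<comment> \<open>The shift back to 0-based pairs: \<open>eq\<close> speaks of successors, and
      \<open>1 \<le> a\<close> makes the truncated subtraction exact.\<close>
    case 4
    have "a - 1 \<le> b - 1 \<and> b - 1 < n \<and> (a - 1 \<in> S \<longrightarrow> b - 1 < f (a - 1)) \<and>
        (b - 1 \<in> S \<longrightarrow> a - 1 < f (b - 1))"
      if "1 \<le> a" "a \<le> b" "b \<le> n" "rank_control ?A a b = rank_control ?A (a - 1) (b - 1)" for a b
      using eq[of "a - 1" "b - 1"] that by auto
    then show ?case by auto
  qed (auto simp: eq)
  from bij_betw_same_card[OF this] show ?thesis
    by (simp add: frakD_def)
qed

section \<open>The reduced permutation\<close>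

lemma zero_rows_involution_mat:
  assumes "finite_involution S f" and S: "S \<subseteq> {..<n}"
  shows "zero_rows (involution_mat n S f :: 'a::field mat) = Suc ` ({..<n} - S)"
proof -
  interpret finite_involution S f by fact
  let ?A = "involution_mat n S f :: 'a mat"
  have *: "row ?A a = 0\<^sub>v n \<longleftrightarrow> a \<notin> S" if "a < n" for a
  proof
    assume zero: "row ?A a = 0\<^sub>v n"
    show "a \<notin> S"
    proof
      assume "a \<in> S"
      with closed S have "f a < n" by auto
      with arg_cong[OF zero, of "\<lambda>v. v $ f a"] \<open>a < n\<close> \<open>a \<in> S\<close> show False
        by (simp add: involution_mat_def)
    qed
  qed (use that in \<open>auto simp: involution_mat_def\<close>)
  have d: "dim_row ?A = n" "dim_col ?A = n" by (auto simp: involution_mat_def)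
  show ?thesis
  proof (rule Set.set_eqI)
    fix x show "x \<in> zero_rows ?A \<longleftrightarrow> x \<in> Suc ` ({..<n} - S)"
      by (cases x) (auto simp: zero_rows_def d *)
  qed
qed

lemma zero_cols_eq_zero_rows:
  assumes "transpose_mat A = A"
  shows "zero_cols A = zero_rows A"
proof -
  have d: "dim_row A = dim_col A" using assms by (metis index_transpose_mat(2))
  have "col A a = row A a" if "a < dim_col A" for a
    using that assms row_transpose by metis
  then show ?thesis by (auto simp: zero_cols_def zero_rows_def d)
qed

lemma transpose_involution_mat:
  assumes "finite_involution S f"
  shows "transpose_mat (involution_mat n S f) = involution_mat n S f"
proof -
  interpret finite_involution S f by fact
  show ?thesis
    by (rule eq_matI) (auto simp: involution_mat_def closed involutive)
qed

text \<open>Supplies the uniqueness required by the definite description in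
  \<open>reduced_perm\<close>.\<close>

lemma perm_matrix_inj:
  assumes "\<sigma> permutes {1..m}" "\<tau> permutes {1..m}"
    and eq: "(perm_matrix m \<sigma> :: 'a::field mat) = perm_matrix m \<tau>"
  shows "\<sigma> = \<tau>"
proof
  fix x show "\<sigma> x = \<tau> x"
  proof (cases "x \<in> {1..m}")
    case True
    then have "\<sigma> x \<in> {1..m}" using assms(1) permutes_in_image by metis
    with True arg_cong[OF eq, of "\<lambda>M. M $$ (x - 1, \<sigma> x - 1)"] show ?thesis
      by (auto simp: perm_matrix_def split: if_splits)
  next
    case False
    then show ?thesis using assms(1,2) permutes_not_in by metis
  qed
qed

text \<open>Deleting zero rows and columns renumbers \<open>S\<close> increasingly. The map
  \<open>p\<close> undoes this renumbering: it is the order isomorphism onto \<open>S\<close> that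
  carries the reduced permutation to \<open>f\<close>.\<close>

lemma reduced_perm_involution_mat:
  fixes S :: "nat set"
  assumes "finite_involution S f" and S: "S \<subseteq> {..<n}"
  defines "\<sigma> \<equiv> reduced_perm (involution_mat n S f :: 'a::field mat)"
  obtains p where "bij_betw p {1..card S} S"
    and "\<And>x y. x \<in> {1..card S} \<Longrightarrow> y \<in> {1..card S} \<Longrightarrow> p x < p y \<longleftrightarrow> x < y"
    and "\<And>x. x \<in> {1..card S} \<Longrightarrow> \<sigma> x \<in> {1..card S} \<and> p (\<sigma> x) = f (p x)"
proof -
  interpret finite_involution S f by fact
  let ?A = "involution_mat n S f :: 'a mat"
  let ?m = "card S"
  define I where "I = {i. Suc i \<notin> zero_rows ?A}"
  \<comment> \<open>Indices from \<open>n\<close> on are never zero rows, so the selecting set is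
    infinite. Thus \<open>pick I\<close> is strictly increasing everywhere, and its first
    \<open>card S\<close> values are the elements of \<open>S\<close>.\<close>
  have IS: "I = S \<union> {n..}"
    using S by (auto simp: I_def zero_rows_involution_mat[OF assms(1) S])
  have inf: "infinite I" by (simp add: IS infinite_Ici)
  have d: "dim_row ?A = n" "dim_col ?A = n" by (auto simp: involution_mat_def)
  have In: "{i. i < n \<and> i \<in> I} = S" using S by (auto simp: IS)
  have B: "delete_zeros ?A = mat ?m ?m (\<lambda>(a, b). ?A $$ (pick I a, pick I b))"
    unfolding delete_zeros_def submatrix_def
      zero_cols_eq_zero_rows[OF transpose_involution_mat[OF assms(1)]] I_def[symmetric] d In ..
  \<comment> \<open>The position of \<open>i\<close> in the increasing enumeration of
    \<open>I\<close>; on \<open>S\<close> it inverts \<open>pick I\<close>.\<close>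
  define c where "c i = card {a \<in> I. a < i}" for i
  have pick_S: "pick I a \<in> S" if "a < ?m" for a
    using that pick_le[of a n I] pick_in_set_inf[OF inf, of a] In by auto
  have c_less: "c i < ?m" if "i \<in> S" for i
    unfolding c_def using that S by (intro psubset_card_mono finite_S) (auto simp: IS)
  have pick_c: "pick I (c i) = i" if "i \<in> S" for i
    unfolding c_def using that by (intro pick_card_in_set) (simp add: IS)
  have pick_less: "pick I a < pick I b \<longleftrightarrow> a < b" for a b
    using pick_mono_inf[OF inf] by (metis linorder_neqE_nat order_less_asym)
  define p where "p x = pick I (x - 1)" for x
  \<comment> \<open>The conjugate of \<open>f\<close> by \<open>p\<close>, extended by the identity
    as \<open>permutes\<close> demands; \<open>Suc\<close> passes from 0-based positions to 1-based
    labels.\<close>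
  define \<tau> where "\<tau> x = (if x \<in> {1..?m} then Suc (c (f (p x))) else x)" for x
  have pS: "p x \<in> S" if "x \<in> {1..?m}" for x using that pick_S unfolding p_def by auto
  have \<tau>_in: "\<tau> x \<in> {1..?m}" if "x \<in> {1..?m}" for x
    using that c_less[OF closed[OF pS[OF that]]] by (auto simp: \<tau>_def)
  have p_\<tau>: "p (\<tau> x) = f (p x)" if "x \<in> {1..?m}" for x
    using that pick_c[OF closed[OF pS[OF that]]] by (simp add: \<tau>_def p_def)
  have p_less: "p x < p y \<longleftrightarrow> x < y" if "x \<in> {1..?m}" "y \<in> {1..?m}" for x y
    using that by (auto simp: p_def pick_less)
  have p_inj: "x = y" if "p x = p y" "x \<in> {1..?m}" "y \<in> {1..?m}" for x y
    using p_less that by (metis linorder_neqE_nat order_less_irrefl)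
  have "bij_betw p {1..?m} S"
  proof (rule bij_betw_byWitness[where f' = "\<lambda>i. Suc (c i)"])
    show "\<forall>x\<in>{1..?m}. Suc (c (p x)) = x"
    proof
      fix x assume x: "x \<in> {1..?m}"
      then have "p (Suc (c (p x))) = p x" using pick_c[OF pS] by (simp add: p_def)
      then show "Suc (c (p x)) = x"
        using p_inj x c_less[OF pS[OF x]] by auto
    qed
    show "(\<lambda>i. Suc (c i)) ` S \<subseteq> {1..?m}" using c_less by (auto simp: Suc_le_eq)
  qed (use pick_c pS in \<open>auto simp: p_def\<close>)
  moreover have "\<sigma> = \<tau>"
  proof -
    have "\<tau> (\<tau> x) = x" for x
    proof (cases "x \<in> {1..?m}")
      case True
      then have "p (\<tau> (\<tau> x)) = p x" using p_\<tau> \<tau>_in pS involutive by simp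
      then show ?thesis using p_inj True \<tau>_in by blast
    next
      case False
      then have "\<tau> x = x" unfolding \<tau>_def by (rule if_not_P)
      then show ?thesis by simp
    qed
    then have perm: "\<tau> permutes {1..?m}"
      unfolding permutes_def by (metis \<tau>_def)
    have mat: "delete_zeros ?A = perm_matrix ?m \<tau>"
    proof (rule eq_matI)
      fix a b assume "a < dim_row (perm_matrix ?m \<tau> :: 'a mat)"
        "b < dim_col (perm_matrix ?m \<tau> :: 'a mat)"
      then have ab: "a < ?m" "b < ?m" by (auto simp: perm_matrix_def)
      have "f (pick I a) = pick I b \<longleftrightarrow> \<tau> (Suc a) = Suc b"
        using p_\<tau>[of "Suc a"] p_inj[of "\<tau> (Suc a)" "Suc b"] \<tau>_in[of "Suc a"] ab
        by (auto simp: p_def)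
      then show "delete_zeros ?A $$ (a, b) = perm_matrix ?m \<tau> $$ (a, b)"
        using ab pick_S[of a] pick_S[of b] S[THEN subsetD, of "pick I a"]
          S[THEN subsetD, of "pick I b"] unfolding B
        by (auto simp: perm_matrix_def involution_mat_def)
    qed (auto simp: B perm_matrix_def)
    have "dim_row (delete_zeros ?A) = ?m" by (simp add: B)
    then show ?thesis
      unfolding \<sigma>_def reduced_perm_def using perm mat perm_matrix_inj
      by (intro the_equality) auto
  qed
  ultimately show thesis using that p_less p_\<tau> \<tau>_in by blast
qed

text \<open>An order isomorphism intertwining the two maps preserves every comparison between points
  and their images, so it carries excedances to excedances and inversions to inversions.\<close>

lemma exc_inv_count_reduced_perm:
  assumes "finite_involution S f" and "S \<subseteq> {..<n}"
  defines "\<sigma> \<equiv> reduced_perm (involution_mat n S f :: 'a::field mat)"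
  shows "exc (card S) \<sigma> = card (finite_involution.excedances S f)"
    and "inv_count (card S) \<sigma> = card (finite_involution.inversions S f)"
proof -
  interpret finite_involution S f by fact
  define M where "M = {1..card S}"
  obtain p where bij: "bij_betw p M S"
    and less: "\<And>x y. x \<in> M \<Longrightarrow> y \<in> M \<Longrightarrow> p x < p y \<longleftrightarrow> x < y"
    and \<sigma>: "\<And>x. x \<in> M \<Longrightarrow> \<sigma> x \<in> M \<and> p (\<sigma> x) = f (p x)"
    using reduced_perm_involution_mat[OF assms(1,2), where 'a = 'a]
    unfolding \<sigma>_def M_def by metis
  have inj: "inj_on p M" and img: "p ` M = S" using bij by (auto simp: bij_betw_def)
  have exc_iff: "p x < f (p x) \<longleftrightarrow> x < \<sigma> x" if "x \<in> M" for x
    using less[of x "\<sigma> x"] \<sigma> that by simp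
  have inv_iff: "f (p y) < f (p x) \<longleftrightarrow> \<sigma> y < \<sigma> x" if "x \<in> M" "y \<in> M" for x y
    using less[of "\<sigma> y" "\<sigma> x"] \<sigma> that by simp
  have "excedances = p ` {x \<in> M. x < \<sigma> x}"
    unfolding excedances_def unfolding img[symmetric] by (auto simp: exc_iff)
  moreover have "inj_on p {x \<in> M. x < \<sigma> x}"
    using inj by (rule inj_on_subset) auto
  ultimately show "exc (card S) \<sigma> = card excedances"
    unfolding exc_def M_def[symmetric] by (simp add: card_image)
  let ?N = "{(x, y). x \<in> M \<and> y \<in> M \<and> x < y \<and> \<sigma> y < \<sigma> x}"
  have "inversions = map_prod p p ` ?N"
    unfolding inversions_def unfolding img[symmetric] by (auto simp: inv_iff less image_iff)
  moreover have "inj_on (map_prod p p) ?N"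
    using map_prod_inj_on[OF inj inj] by (rule inj_on_subset) auto
  ultimately show "inv_count (card S) \<sigma> = card inversions"
    unfolding inv_count_def M_def[symmetric] by (simp add: card_image)
qed

section \<open>The formula for \<open>frakD\<close>\<close>

theorem theorem8p1:
  fixes n k :: nat
    and \<pi> :: "'a::field mat"
    and i :: "nat \<Rightarrow> nat"
  assumes "partial_involution n \<pi>"
    and "k \<le> n"
    and "vec_space.rank n \<pi> = n - k"
    and "bij_betw i {1..k} (zero_rows \<pi>)"
  shows "real (frakD n \<pi>) =
    (real (exc (n - k) (reduced_perm \<pi>)) + real (inv_count (n - k) (reduced_perm \<pi>))) / 2
    + (\<Sum>t = 1..k. real n + 1 - real (i t))"
proof -
  obtain S f where fi: "finite_involution S f" and S: "S \<subseteq> {..<n}"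
    and \<pi>: "\<pi> = involution_mat n S f"
    using partial_involution_imp_involution_mat[OF assms(1)] .
  interpret finite_involution S f by (rule fi)
  have Z: "zero_rows \<pi> = Suc ` ({..<n} - S)"
    unfolding \<pi> by (rule zero_rows_involution_mat[OF fi S])
  have "k = card (zero_rows \<pi>)" using bij_betw_same_card[OF assms(4)] by simp
  also have "\<dots> = n - card S"
    unfolding Z using S finite_S by (simp add: card_image card_Diff_subset)
  \<comment> \<open>Inverting \<open>k = n - card S\<close> under truncated subtraction needs
    \<open>card S \<le> n\<close>, which \<open>card_mono\<close> provides.\<close>
  finally have m: "n - k = card S"
    using card_mono[OF _ S] by simp
  have "(\<Sum>t = 1..k. real n + 1 - real (i t)) = (\<Sum>x\<in>zero_rows \<pi>. real n + 1 - real x)"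
    by (rule sum.reindex_bij_betw[OF assms(4)])
  \<comment> \<open>The zero row with 1-based index \<open>Suc z\<close> contributes
    \<open>n + 1 - Suc z = n - z\<close>.\<close>
  also have "\<dots> = (\<Sum>z\<in>{..<n} - S. real (n - z))"
    unfolding Z by (subst sum.reindex) (auto intro!: sum.cong simp: of_nat_diff)
  finally have sum: "(\<Sum>t = 1..k. real n + 1 - real (i t)) = real (\<Sum>z\<in>{..<n} - S. n - z)"
    by simp
  have "frakD n \<pi> = card excedances + card crossings + (\<Sum>z\<in>{..<n} - S. n - z)"
    unfolding \<pi> frakD_involution_mat[OF fi S] by (rule card_extended_crossings[OF fi S])
  moreover have "exc (n - k) (reduced_perm \<pi>) = card excedances"
    and "inv_count (n - k) (reduced_perm \<pi>) = card inversions"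
    unfolding m \<pi> by (rule exc_inv_count_reduced_perm[OF fi S])+
  \<comment> \<open>By \<open>card_inversions\<close>, half the sum of excedances and inversions is
    the number of excedances plus the number of \<open>crossings\<close>.\<close>
  ultimately show ?thesis
    unfolding sum by (simp add: card_inversions)
qed

end
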